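(* Let $B$ be a real Banach space, let $Q\ge0$ be an integer, and let $J_1,\dots,J_Q$ be finite sets. For deterministic coefficients $a_{i_1,\dots,i_Q}\in B$ ($i_t\in J_t$) set $$F(X)=\sum_{i_1\in J_1,\dots,i_Q\in J_Q}a_{i_1,\dots,i_Q}\prod_{t=1}^QX^{(t)}_{i_t}.$$ Assume that all coordinates $X^{(t)}_i$ ($1\le t\le Q$, $i\in J_t$) are mutually independent real random variables with $\mathbb EX^{(t)}_i=0$, $\mathbb E(X^{(t)}_i)^2=1$, and $|X^{(t)}_i|\le K$ almost surely, where $K\ge1$ is common to all coordinates (no symmetry or identical-law assumption is imposed). Let $F(\varepsilon)$ be defined with the same coefficients and mutually independent uniform signs $\varepsilon^{(t)}_i\in\{-1,1\}$ in place of the $X^{(t)}_i$. Then for every $1\le p<\infty$, $$(2K)^{-Q}\big(\mathbb E\|F(\varepsilon)\|^p\big)^{1/p}\le\big(\mathbb E\|F(X)\|^p\big)^{1/p}\le(2K)^Q\big(\mathbb E\|F(\varepsilon)\|^p\big)^{1/p}.$$ (The constants are thus independent of $p$, the index-set sizes, and $B$; for $Q=0$ the comparison is equality.) *)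

theory Defs
  imports "HOL-Probability.Probability"
begin

text \<open>
  The sum ranges over multi-indices \<open>i\<close> with \<open>i t \<in> J t\<close> for \<open>1 \<le> t \<le> Q\<close>; for \<open>Q = 0\<close> there is
  exactly one, the constant function \<open>undefined\<close>, and the chaos is the constant coefficient.
\<close>

definition decoupled_chaos ::
  "nat \<Rightarrow> (nat \<Rightarrow> 'i set) \<Rightarrow> ((nat \<Rightarrow> 'i) \<Rightarrow> 'b::real_vector) \<Rightarrow> (nat \<Rightarrow> 'i \<Rightarrow> real) \<Rightarrow> 'b" where
  "decoupled_chaos Q J a x =
     (\<Sum>i\<in>PiE {1..Q} J. (\<Prod>t=1..Q. x t (i t)) *\<^sub>R a i)"

definition coordinates :: "nat \<Rightarrow> (nat \<Rightarrow> 'i set) \<Rightarrow> (nat \<times> 'i) set" where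
  "coordinates Q J = (SIGMA t:{1..Q}. J t)"

definition uniform_sign :: "'a measure \<Rightarrow> ('a \<Rightarrow> real) \<Rightarrow> bool" where
  "uniform_sign M e \<longleftrightarrow> e \<in> borel_measurable M \<and>
     measure M {\<omega> \<in> space M. e \<omega> = 1} = 1 / 2 \<and>
     measure M {\<omega> \<in> space M. e \<omega> = -1} = 1 / 2"

definition Lp_norm :: "real \<Rightarrow> 'a measure \<Rightarrow> ('a \<Rightarrow> 'b::real_normed_vector) \<Rightarrow> real" where
  "Lp_norm p M Y = (LINT \<omega>|M. norm (Y \<omega>) powr p) powr (1 / p)"

end

theory Submission
  imports Defs
begin

text \<open>
  The chaos is affine in each single coordinate, so \<open>norm F powr p\<close> is a convex function of each
  coordinate when the others are fixed.  Expectations of separately convex functions of independent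
  variables are monotone in the laws of the variables for the convex order (\<open>\<mu>\<close> is below \<open>\<nu>\<close> when
  every convex function has a smaller integral under \<open>\<mu>\<close> than under \<open>\<nu>\<close>): the laws can be replaced
  one coordinate at a time, by Fubini.  This is \<open>indep_separately_convex_mono\<close>.

  It remains to compare one coordinate \<open>x\<close>, centred, of variance one and bounded by \<open>K\<close>, with a
  sign \<open>e\<close>.  In the convex order, \<open>e / K\<close> is below \<open>x\<close> and \<open>x\<close> is below \<open>K e\<close>.  Both facts come
  from the weights \<open>(1 + x / K) / 2\<close> and \<open>(1 - x / K) / 2\<close>, which are nonnegative and sum to one.
  They write \<open>x\<close> as a convex combination of \<open>K\<close> and \<open>- K\<close>, and each has expectation one half; this
  gives the upper bound (\<open>convex_le_two_point\<close>).  They also split the law of \<open>x\<close> into two halves,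
  whose barycentres are \<open>1 / K\<close> and \<open>- 1 / K\<close> because \<open>x\<close> has variance one; Jensen's inequality on
  each half gives the lower bound (\<open>two_point_convex_le\<close>).

  Since the chaos is homogeneous of degree \<open>Q\<close>, scaling the signs by \<open>K\<close> or by \<open>1 / K\<close> multiplies
  the norm by \<open>K ^ Q\<close> or by its inverse, and \<open>K ^ Q \<le> (2 * K) ^ Q\<close>.
\<close>

section \<open>Convex functions of a bounded random variable\<close>

lemma convex_on_UNIV_measurable:
  fixes f :: "real \<Rightarrow> real"
  assumes "convex_on UNIV f"
  shows "f \<in> borel_measurable borel"
  using assms by (intro borel_measurable_continuous_onI convex_on_continuous) auto

lemma (in prob_space) integrable_convex_bounded:
  fixes f :: "real \<Rightarrow> real"
  assumes f: "convex_on UNIV f" and X: "X \<in> borel_measurable M" and R: "AE \<omega> in M. \<bar>X \<omega>\<bar> \<le> R"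
  shows "integrable M (\<lambda>\<omega>. f (X \<omega>))"
proof -
  have "continuous_on UNIV f"
    using f by (intro convex_on_continuous) auto
  then have "bounded (f ` {-R..R})"
    by (meson compact_Icc compact_continuous_image compact_imp_bounded continuous_on_subset
        subset_UNIV)
  then obtain B where B: "\<And>y. y \<in> {-R..R} \<Longrightarrow> norm (f y) \<le> B"
    unfolding bounded_iff by blast
  have "AE \<omega> in M. norm (f (X \<omega>)) \<le> B"
    using R by eventually_elim (rule B, auto)
  moreover have "(\<lambda>\<omega>. f (X \<omega>)) \<in> borel_measurable M"
    using measurable_compose[OF X convex_on_UNIV_measurable[OF f]] .
  ultimately show ?thesis
    by (intro integrable_const_bound)
qed

lemma convex_on_supporting_line:
  fixes f :: "real \<Rightarrow> real"
  assumes "convex_on UNIV f"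
  obtains k where "\<And>y. f c + k * (y - c) \<le> f y"
  using convex_le_Inf_differential[OF assms, of c] by auto

lemma convex_on_norm_affine_powr:
  fixes A B :: "'b::real_normed_vector"
  assumes "1 \<le> p"
  shows "convex_on UNIV (\<lambda>y::real. norm (A + y *\<^sub>R B) powr p)"
proof (rule convex_onI)
  fix t x y :: real assume t: "0 < t" "t < 1"
  define u v where "u = norm (A + x *\<^sub>R B)" and "v = norm (A + y *\<^sub>R B)"
  have "A + ((1 - t) *\<^sub>R x + t *\<^sub>R y) *\<^sub>R B = (1 - t) *\<^sub>R (A + x *\<^sub>R B) + t *\<^sub>R (A + y *\<^sub>R B)"
    by (simp add: algebra_simps)
  then have "norm (A + ((1 - t) *\<^sub>R x + t *\<^sub>R y) *\<^sub>R B) \<le> (1 - t) * u + t * v"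
    using t unfolding u_def v_def
    by (metis abs_of_pos diff_gt_0_iff_gt norm_scaleR norm_triangle_ineq)
  then have "norm (A + ((1 - t) *\<^sub>R x + t *\<^sub>R y) *\<^sub>R B) powr p \<le> ((1 - t) * u + t * v) powr p"
    using assms by (intro powr_mono2) auto
  also have "\<dots> \<le> (1 - t) * u powr p + t * v powr p"
    \<comment> \<open>convexity of \<open>powr p\<close> comes from the open half-line; the endpoint zero is treated directly\<close>
  proof (cases "u = 0 \<or> v = 0")
    case True
    have shrink: "(s * w) powr p \<le> s * w powr p" if "0 \<le> s" "s \<le> 1" "0 \<le> w" for s w :: real
    proof -
      have "s powr p \<le> s powr 1"
        using that assms by (intro powr_mono') auto
      then show ?thesis
        using that by (simp add: powr_mult mult_right_mono)
    qed
    show ?thesis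
      using True shrink[of t v] shrink[of "1 - t" u] t assms by (auto simp: u_def v_def)
  next
    case False
    then have "u \<in> {0<..}" "v \<in> {0<..}"
      by (auto simp: u_def v_def)
    then show ?thesis
      using convex_onD[OF powr_convex[OF assms], of t u v] t by simp
  qed
  finally show "norm (A + ((1 - t) *\<^sub>R x + t *\<^sub>R y) *\<^sub>R B) powr p
      \<le> (1 - t) * norm (A + x *\<^sub>R B) powr p + t * norm (A + y *\<^sub>R B) powr p"
    by (simp add: u_def v_def)
qed auto

section \<open>Comparison of one coordinate with a sign\<close>

text \<open>
  The integral of a function that is not integrable is zero, so the relation is meaningful only
  between laws with bounded support, where every convex function is integrable.
\<close>

definition convex_le :: "real measure \<Rightarrow> real measure \<Rightarrow> bool" where
  "convex_le \<mu> \<nu> \<longleftrightarrow> (\<forall>f. convex_on UNIV f \<longrightarrow> (LINT y|\<mu>. f y) \<le> (LINT y|\<nu>. f y))"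

definition two_point_mean :: "real \<Rightarrow> (real \<Rightarrow> real) \<Rightarrow> real" where
  "two_point_mean c f = (f c + f (- c)) / 2"

text \<open>
  The chord of \<open>f\<close> over the interval from \<open>- K\<close> to \<open>K\<close> lies above \<open>f\<close>; being affine, it has at a
  centred variable the expectation that it takes at zero.
\<close>

lemma (in prob_space) convex_le_two_point:
  assumes X: "X \<in> borel_measurable M" and K: "0 < K" and bound: "AE \<omega> in M. \<bar>X \<omega>\<bar> \<le> K"
    and mean: "(LINT \<omega>|M. X \<omega>) = 0" and f: "convex_on UNIV f"
  shows "(LINT \<omega>|M. f (X \<omega>)) \<le> two_point_mean K f"
proof -
  have intX: "integrable M X"
    using bound X by (intro integrable_const_bound[of _ K]) auto
  define w where "w x = (1 + x / K) / 2" for x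
  have "AE \<omega> in M. f (X \<omega>) \<le> (f K + f (- K)) / 2 + X \<omega> * ((f K - f (- K)) / (2 * K))"
    using bound
  proof eventually_elim
    fix \<omega> assume b: "\<bar>X \<omega>\<bar> \<le> K"
    have "0 \<le> w (X \<omega>)" "w (X \<omega>) \<le> 1"
      using b K by (auto simp: w_def field_simps)
    then have "f ((1 - w (X \<omega>)) * (- K) + w (X \<omega>) * K) \<le> (1 - w (X \<omega>)) * f (- K) + w (X \<omega>) * f K"
      using convex_onD[OF f, of "w (X \<omega>)" "- K" K] by simp
    also have "(1 - w (X \<omega>)) * (- K) + w (X \<omega>) * K = X \<omega>"
      using K by (simp add: w_def field_simps)
    also have "(1 - w (X \<omega>)) * f (- K) + w (X \<omega>) * f K
        = (f K + f (- K)) / 2 + X \<omega> * ((f K - f (- K)) / (2 * K))"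
      using K by (simp add: w_def field_simps)
    finally show "f (X \<omega>) \<le> (f K + f (- K)) / 2 + X \<omega> * ((f K - f (- K)) / (2 * K))" .
  qed
  then have "(LINT \<omega>|M. f (X \<omega>))
      \<le> (LINT \<omega>|M. (f K + f (- K)) / 2 + X \<omega> * ((f K - f (- K)) / (2 * K)))"
    using integrable_convex_bounded[OF f X bound] intX by (intro integral_mono_AE) auto
  also have "\<dots> = (f K + f (- K)) / 2"
    using intX mean by (simp add: prob_space)
  finally show ?thesis
    by (simp add: two_point_mean_def)
qed

text \<open>
  Reweighting the law of \<open>X\<close> by \<open>1 + X / K\<close> gives a probability measure, and its mean is
  \<open>E X + E X\<^sup>2 / K = 1 / K\<close>; likewise \<open>1 - X / K\<close> gives the mean \<open>- 1 / K\<close>.  The law of \<open>X\<close> is the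
  average of the two, so Jensen's inequality for each of them yields the bound.
\<close>

lemma (in prob_space) two_point_convex_le:
  assumes X: "X \<in> borel_measurable M" and K: "0 < K" and bound: "AE \<omega> in M. \<bar>X \<omega>\<bar> \<le> K"
    and mean: "(LINT \<omega>|M. X \<omega>) = 0" and var: "(LINT \<omega>|M. (X \<omega>)\<^sup>2) = 1" and f: "convex_on UNIV f"
  shows "two_point_mean (1 / K) f \<le> (LINT \<omega>|M. f (X \<omega>))"
proof -
  have intX: "integrable M X"
    using bound X by (intro integrable_const_bound[of _ K]) auto
  have intX2: "integrable M (\<lambda>\<omega>. (X \<omega>)\<^sup>2)"
    using var not_integrable_integral_eq by fastforce
  obtain k where k: "\<And>y. f (1 / K) + k * (y - 1 / K) \<le> f y"
    using convex_on_supporting_line[OF f] by metis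
  obtain l where l: "\<And>y. f (- 1 / K) + l * (y - (- 1 / K)) \<le> f y"
    using convex_on_supporting_line[OF f] by metis
  \<comment> \<open>the two supporting lines, averaged with the weights \<open>(1 + x / K) / 2\<close> and \<open>(1 - x / K) / 2\<close>\<close>
  define h where "h x = (1 + x / K) / 2 * (f (1 / K) + k * (x - 1 / K))
      + (1 - x / K) / 2 * (f (- 1 / K) + l * (x - (- 1 / K)))" for x
  define c1 where "c1 = (f (1 / K) / K + k * (1 - 1 / K\<^sup>2) - f (- 1 / K) / K + l * (1 - 1 / K\<^sup>2)) / 2"
  have h: "h x = (f (1 / K) + f (- 1 / K)) / 2 + (l - k) / (2 * K) + x * c1 + x\<^sup>2 * ((k - l) / (2 * K))" for x
    using K by (simp add: h_def c1_def field_simps power2_eq_square)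
  have "AE \<omega> in M. h (X \<omega>) \<le> f (X \<omega>)"
    using bound
  proof eventually_elim
    fix \<omega> assume "\<bar>X \<omega>\<bar> \<le> K"
    then have "0 \<le> (1 + X \<omega> / K) / 2" "0 \<le> (1 - X \<omega> / K) / 2"
      using K by (auto simp: field_simps)
    then have "h (X \<omega>) \<le> (1 + X \<omega> / K) / 2 * f (X \<omega>) + (1 - X \<omega> / K) / 2 * f (X \<omega>)"
      unfolding h_def by (intro add_mono mult_left_mono k l)
    also have "\<dots> = f (X \<omega>)"
      by (simp add: field_simps)
    finally show "h (X \<omega>) \<le> f (X \<omega>)" .
  qed
  moreover have "integrable M (\<lambda>\<omega>. h (X \<omega>))"
    unfolding h using intX intX2 by auto
  ultimately have "(LINT \<omega>|M. h (X \<omega>)) \<le> (LINT \<omega>|M. f (X \<omega>))"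
    using integrable_convex_bounded[OF f X bound] by (intro integral_mono_AE)
  \<comment> \<open>the slopes \<open>k\<close> and \<open>l\<close> cancel because the second moment is one\<close>
  moreover have "(LINT \<omega>|M. h (X \<omega>)) = (f (1 / K) + f (- 1 / K)) / 2"
    unfolding h using intX intX2 mean var by (simp add: prob_space) (simp add: diff_divide_distrib)
  ultimately show ?thesis
    by (simp add: two_point_mean_def)
qed

lemma (in prob_space) uniform_sign_AE:
  assumes "uniform_sign M e"
  shows "AE \<omega> in M. e \<omega> = 1 \<or> e \<omega> = - 1"
proof -
  have [measurable]: "e \<in> borel_measurable M"
    using assms by (simp add: uniform_sign_def)
  have "prob ({\<omega> \<in> space M. e \<omega> = 1} \<union> {\<omega> \<in> space M. e \<omega> = - 1})
      = prob {\<omega> \<in> space M. e \<omega> = 1} + prob {\<omega> \<in> space M. e \<omega> = - 1}"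
    by (rule finite_measure_Union) auto
  also have "\<dots> = 1"
    using assms by (simp add: uniform_sign_def)
  finally have "AE \<omega> in M. \<omega> \<in> {\<omega> \<in> space M. e \<omega> = 1} \<union> {\<omega> \<in> space M. e \<omega> = - 1}"
    by (subst (asm) prob_eq_1) auto
  then show ?thesis
    by eventually_elim auto
qed

lemma (in prob_space) expectation_scaled_sign:
  assumes e: "uniform_sign M e" and f: "f \<in> borel_measurable borel"
  shows "(LINT \<omega>|M. f (c * e \<omega>)) = two_point_mean c f"
proof -
  have [measurable]: "e \<in> borel_measurable M" "f \<in> borel_measurable borel"
    using assms by (auto simp: uniform_sign_def)
  let ?P = "{\<omega> \<in> space M. e \<omega> = 1}" and ?N = "{\<omega> \<in> space M. e \<omega> = - 1}"
  have "(LINT \<omega>|M. f (c * e \<omega>)) = (LINT \<omega>|M. f c * indicator ?P \<omega> + f (- c) * indicator ?N \<omega>)"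
    using uniform_sign_AE[OF e] AE_space
    by (intro integral_cong_AE; (measurable)?) (auto split: split_indicator)
  also have "\<dots> = f c * prob ?P + f (- c) * prob ?N"
    by (subst Bochner_Integration.integral_add) (auto intro!: integrable_real_indicator simp: emeasure_eq_measure)
  finally show ?thesis
    using e by (simp add: uniform_sign_def two_point_mean_def field_simps)
qed

section \<open>Monotonicity for separately convex functions\<close>

definition separately_convex :: "(('i \<Rightarrow> real) \<Rightarrow> real) \<Rightarrow> bool" where
  "separately_convex g \<longleftrightarrow> (\<forall>x i. convex_on UNIV (\<lambda>y. g (x(i := y))))"

lemma separately_convex_integral:
  assumes g: "separately_convex g" and \<mu>: "prob_space \<mu>" "sets \<mu> = sets borel"
    and R: "AE y in \<mu>. \<bar>y\<bar> \<le> R"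
  shows "separately_convex (\<lambda>x. LINT y|\<mu>. g (x(i := y)))"
  unfolding separately_convex_def
proof (intro allI)
  fix x :: "'a \<Rightarrow> real" and j
  interpret prob_space \<mu> by fact
  have int: "integrable \<mu> (\<lambda>y. g (x(i := y)))" for x
    using g R \<mu>(2) by (intro integrable_convex_bounded[where X = "\<lambda>y. y"])
      (auto simp: separately_convex_def measurable_cong_sets[of \<mu> borel])
  show "convex_on UNIV (\<lambda>z. LINT y|\<mu>. g (x(j := z, i := y)))"
  proof (cases "j = i")
    case True
    then show ?thesis by (simp add: convex_on_const)
  next
    case False
    have "(LINT y|\<mu>. g (x(j := (1 - t) *\<^sub>R z + t *\<^sub>R z', i := y)))
        \<le> (LINT y|\<mu>. (1 - t) * g (x(j := z, i := y)) + t * g (x(j := z', i := y)))"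
      if "0 < t" "t < 1" for t z z' :: real
    proof (rule integral_mono)
      fix y
      have "convex_on UNIV (\<lambda>z. g (x(i := y, j := z)))"
        using g by (simp add: separately_convex_def)
      from convex_onD[OF this, of t z z'] show
        "g (x(j := (1 - t) *\<^sub>R z + t *\<^sub>R z', i := y))
          \<le> (1 - t) * g (x(j := z, i := y)) + t * g (x(j := z', i := y))"
        using that False by (simp add: fun_upd_twist)
    qed (use int in auto)
    then show ?thesis
      by (intro convex_onI) (auto simp: int)
  qed
qed

text \<open>
  The induction replaces the laws one at a time.  The coordinate \<open>i\<close> is integrated out first, under
  its old law, which leaves a separately convex function of the remaining coordinates; the induction
  hypothesis changes their laws, and only then is the law of \<open>i\<close> changed, for fixed values of the
  others.  Boundedness of the old laws keeps the intermediate function finite.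
\<close>

lemma product_separately_convex_mono:
  fixes \<mu> \<nu> :: "'i \<Rightarrow> real measure"
  assumes "finite I"
    and \<mu>: "\<And>i. prob_space (\<mu> i)" "\<And>i. sets (\<mu> i) = sets borel"
    and \<nu>: "\<And>i. prob_space (\<nu> i)" "\<And>i. sets (\<nu> i) = sets borel"
    and \<mu>R: "\<And>i. i \<in> I \<Longrightarrow> AE y in \<mu> i. \<bar>y\<bar> \<le> R"
    and \<nu>R: "\<And>i. i \<in> I \<Longrightarrow> AE y in \<nu> i. \<bar>y\<bar> \<le> S"
    and le: "\<And>i. i \<in> I \<Longrightarrow> convex_le (\<mu> i) (\<nu> i)"
    and g: "separately_convex g" "\<And>x. 0 \<le> g x" "g \<in> borel_measurable (PiM I (\<lambda>_. borel))"
  shows "(\<integral>\<^sup>+x. ennreal (g x) \<partial>PiM I \<mu>) \<le> (\<integral>\<^sup>+x. ennreal (g x) \<partial>PiM I \<nu>)"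
  using \<open>finite I\<close> \<mu>R \<nu>R le g
proof (induction I arbitrary: g)
  case empty
  then show ?case by (simp add: PiM_empty)
next
  case (insert i I)
  interpret \<mu>: product_prob_space \<mu>
    by (rule product_prob_spaceI) (rule \<mu>)
  interpret \<nu>: product_prob_space \<nu>
    by (rule product_prob_spaceI) (rule \<nu>)
  note conv = insert.prems(4)[unfolded separately_convex_def, rule_format]
  have sets_\<mu>: "sets (PiM A \<mu>) = sets (PiM A (\<lambda>_. borel))" for A
    by (intro sets_PiM_cong) (auto simp: \<mu>)
  have sets_\<nu>: "sets (PiM A \<nu>) = sets (PiM A (\<lambda>_. borel))" for A
    by (intro sets_PiM_cong) (auto simp: \<nu>)
  have g_\<mu>: "(\<lambda>x. ennreal (g x)) \<in> borel_measurable (PiM (insert i I) \<mu>)"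
    and g_\<nu>: "(\<lambda>x. ennreal (g x)) \<in> borel_measurable (PiM (insert i I) \<nu>)"
    using insert.prems(6) by (simp_all add: measurable_cong_sets[OF sets_\<mu> refl]
        measurable_cong_sets[OF sets_\<nu> refl])
  have id_\<mu>: "(\<lambda>y. y) \<in> borel_measurable (\<mu> i)" and id_\<nu>: "(\<lambda>y. y) \<in> borel_measurable (\<nu> i)"
    by (simp_all add: measurable_cong_sets[of "\<mu> i" borel] measurable_cong_sets[of "\<nu> i" borel] \<mu> \<nu>)
  have int_\<mu>: "integrable (\<mu> i) (\<lambda>y. g (x(i := y)))" for x
    using prob_space.integrable_convex_bounded[OF \<mu>(1) conv id_\<mu> insert.prems(1)] by simp
  have int_\<nu>: "integrable (\<nu> i) (\<lambda>y. g (x(i := y)))" for x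
    using prob_space.integrable_convex_bounded[OF \<nu>(1) conv id_\<nu> insert.prems(2)] by simp
  define h where "h x = (LINT y|\<mu> i. g (x(i := y)))" for x
  have h_eq: "ennreal (h x) = (\<integral>\<^sup>+y. ennreal (g (x(i := y))) \<partial>\<mu> i)" for x
    unfolding h_def using int_\<mu> insert.prems(5) by (intro nn_integral_eq_integral[symmetric]) auto
  have h_meas: "h \<in> borel_measurable (PiM I (\<lambda>_. borel))"
  proof -
    have "(\<lambda>(x, y). g (x(i := y))) \<in> borel_measurable (PiM I (\<lambda>_. borel) \<Otimes>\<^sub>M \<mu> i)"
    proof -
      have "(\<lambda>(x, y). x(i := y)) \<in> measurable (PiM I (\<lambda>_. borel) \<Otimes>\<^sub>M borel) (PiM (insert i I) (\<lambda>_. borel))"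
        by (rule measurable_add_dim)
      from measurable_compose[OF this insert.prems(6)] show ?thesis
        unfolding split_beta' measurable_cong_sets[OF sets_pair_measure_cong[OF refl \<mu>(2)] refl] .
    qed
    then show ?thesis
      unfolding h_def by (rule sigma_finite_measure.borel_measurable_lebesgue_integral
          [OF prob_space_imp_sigma_finite[OF \<mu>(1)]])
  qed
  have "(\<integral>\<^sup>+x. ennreal (g x) \<partial>PiM (insert i I) \<mu>) = (\<integral>\<^sup>+x. ennreal (h x) \<partial>PiM I \<mu>)"
    using \<mu>.product_nn_integral_insert[OF insert.hyps g_\<mu>] by (simp add: h_eq)
  also have "\<dots> \<le> (\<integral>\<^sup>+x. ennreal (h x) \<partial>PiM I \<nu>)"
  proof (rule insert.IH)
    show "separately_convex h"
      unfolding h_def using insert.prems \<mu> by (intro separately_convex_integral) auto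
    show "0 \<le> h x" for x
      unfolding h_def using insert.prems(5) by simp
  qed (use insert.prems h_meas in auto)
  also have "\<dots> \<le> (\<integral>\<^sup>+x. (\<integral>\<^sup>+y. ennreal (g (x(i := y))) \<partial>\<nu> i) \<partial>PiM I \<nu>)"
  proof (rule nn_integral_mono)
    fix x
    have "ennreal (h x) \<le> ennreal (LINT y|\<nu> i. g (x(i := y)))"
      using insert.prems(3)[of i] conv[of x i] by (auto simp: h_def convex_le_def intro!: ennreal_leI)
    also have "\<dots> = (\<integral>\<^sup>+y. ennreal (g (x(i := y))) \<partial>\<nu> i)"
      using int_\<nu> insert.prems(5) by (intro nn_integral_eq_integral[symmetric]) auto
    finally show "ennreal (h x) \<le> (\<integral>\<^sup>+y. ennreal (g (x(i := y))) \<partial>\<nu> i)" .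
  qed
  also have "\<dots> = (\<integral>\<^sup>+x. ennreal (g x) \<partial>PiM (insert i I) \<nu>)"
    using \<nu>.product_nn_integral_insert[OF insert.hyps g_\<nu>] by simp
  finally show ?case .
qed

lemma (in prob_space) nn_integral_indep_vars:
  fixes X :: "'i \<Rightarrow> 'a \<Rightarrow> real"
  assumes indep: "indep_vars (\<lambda>_. borel) X I" and g: "g \<in> borel_measurable (PiM I (\<lambda>_. borel))"
  shows "(\<integral>\<^sup>+\<omega>. ennreal (g (\<lambda>i\<in>I. X i \<omega>)) \<partial>M) = (\<integral>\<^sup>+x. ennreal (g x) \<partial>PiM I (\<lambda>i. distr M borel (X i)))"
proof (cases "I = {}")
  case True
  then show ?thesis
    by (simp add: PiM_empty emeasure_space_1 restrict_def nn_integral_count_space_finite)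
next
  case False
  have rv: "random_variable borel (X i)" if "i \<in> I" for i
    using indep that by (simp add: indep_vars_def)
  have "distr M (PiM I (\<lambda>_. borel)) (\<lambda>\<omega>. \<lambda>i\<in>I. X i \<omega>) = PiM I (\<lambda>i. distr M borel (X i))"
    using indep by (simp add: indep_vars_iff_distr_eq_PiM'[OF False rv])
  moreover have "(\<lambda>\<omega>. \<lambda>i\<in>I. X i \<omega>) \<in> measurable M (PiM I (\<lambda>_. borel))"
    using rv by (intro measurable_restrict) auto
  ultimately show ?thesis
    using g by (subst nn_integral_distr[symmetric, where T = "\<lambda>\<omega>. \<lambda>i\<in>I. X i \<omega>"]) auto
qed

lemma indep_separately_convex_mono:
  fixes X :: "'i \<Rightarrow> 'm \<Rightarrow> real" and Y :: "'i \<Rightarrow> 'n \<Rightarrow> real"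
  assumes "finite I" and M: "prob_space M" and N: "prob_space N"
    and X: "prob_space.indep_vars M (\<lambda>_. borel) X I" and Y: "prob_space.indep_vars N (\<lambda>_. borel) Y I"
    and XR: "\<And>i. i \<in> I \<Longrightarrow> AE \<omega> in M. \<bar>X i \<omega>\<bar> \<le> R"
    and YS: "\<And>i. i \<in> I \<Longrightarrow> AE \<omega> in N. \<bar>Y i \<omega>\<bar> \<le> S"
    and le: "\<And>i f. i \<in> I \<Longrightarrow> convex_on UNIV f \<Longrightarrow> (LINT \<omega>|M. f (X i \<omega>)) \<le> (LINT \<omega>|N. f (Y i \<omega>))"
    and g: "separately_convex g" "\<And>x. 0 \<le> g x" "g \<in> borel_measurable (PiM I (\<lambda>_. borel))"
  shows "(\<integral>\<^sup>+\<omega>. ennreal (g (\<lambda>i\<in>I. X i \<omega>)) \<partial>M) \<le> (\<integral>\<^sup>+\<omega>. ennreal (g (\<lambda>i\<in>I. Y i \<omega>)) \<partial>N)"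
proof -
  interpret M: prob_space M by fact
  interpret N: prob_space N by fact
  have Xm: "X i \<in> borel_measurable M" and Ym: "Y i \<in> borel_measurable N" if "i \<in> I" for i
    using X Y that by (auto simp: M.indep_vars_def N.indep_vars_def)
  \<comment> \<open>outside \<open>I\<close> any probability law will do: the product over \<open>I\<close> does not see it\<close>
  define \<mu> where "\<mu> i = (if i \<in> I then distr M borel (X i) else return borel 0)" for i
  define \<nu> where "\<nu> i = (if i \<in> I then distr N borel (Y i) else return borel 0)" for i
  have "(\<integral>\<^sup>+x. ennreal (g x) \<partial>PiM I \<mu>) \<le> (\<integral>\<^sup>+x. ennreal (g x) \<partial>PiM I \<nu>)"
  proof (rule product_separately_convex_mono[where R = R and S = S])
    show "prob_space (\<mu> i)" "prob_space (\<nu> i)" for i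
      by (auto simp: \<mu>_def \<nu>_def Xm Ym M.prob_space_distr N.prob_space_distr prob_space_return)
    show "sets (\<mu> i) = sets borel" "sets (\<nu> i) = sets borel" for i
      by (auto simp: \<mu>_def \<nu>_def)
    have interval: "{y \<in> space borel. \<bar>y\<bar> \<le> r} \<in> sets borel" for r :: real
      by measurable
    show "AE y in \<mu> i. \<bar>y\<bar> \<le> R" if "i \<in> I" for i
      using XR[OF that] that by (simp only: \<mu>_def if_True AE_distr_iff[OF Xm[OF that] interval])
    show "AE y in \<nu> i. \<bar>y\<bar> \<le> S" if "i \<in> I" for i
      using YS[OF that] that by (simp only: \<nu>_def if_True AE_distr_iff[OF Ym[OF that] interval])
    show "convex_le (\<mu> i) (\<nu> i)" if "i \<in> I" for i
      using that le by (auto simp: convex_le_def \<mu>_def \<nu>_def integral_distr Xm Ym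
          convex_on_UNIV_measurable)
  qed (use assms in auto)
  moreover have "PiM I \<mu> = PiM I (\<lambda>i. distr M borel (X i))" "PiM I \<nu> = PiM I (\<lambda>i. distr N borel (Y i))"
    by (auto intro!: PiM_cong simp: \<mu>_def \<nu>_def)
  ultimately show ?thesis
    by (simp add: M.nn_integral_indep_vars[OF X g(3)] N.nn_integral_indep_vars[OF Y g(3)])
qed

section \<open>The decoupled chaos\<close>

lemma PiE_coordinates:
  "\<lbrakk>i \<in> PiE {1..Q} J; t \<in> {1..Q}\<rbrakk> \<Longrightarrow> (t, i t) \<in> coordinates Q J"
  by (auto simp: coordinates_def PiE_mem)

lemma decoupled_chaos_affine:
  "\<exists>A B. \<forall>y. decoupled_chaos Q J a (\<lambda>t i. (x((s, j) := y)) (t, i)) = A + y *\<^sub>R B"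
proof -
  have "\<exists>A B. \<forall>y. (\<Prod>t=1..Q. (x((s, j) := y)) (t, i t)) *\<^sub>R a i = A + y *\<^sub>R B" for i
  proof (cases "s \<in> {1..Q} \<and> i s = j")
    case True
    have "(\<Prod>t=1..Q. (x((s, j) := y)) (t, i t)) = y * (\<Prod>t\<in>{1..Q} - {s}. x (t, i t))" for y
      using True by (subst prod.remove[of _ s]) (auto intro!: prod.cong)
    then show ?thesis
      by (metis add.left_neutral scaleR_scaleR)
  next
    case False
    then have "(\<Prod>t=1..Q. (x((s, j) := y)) (t, i t)) = (\<Prod>t=1..Q. x (t, i t))" for y
      by (intro prod.cong) auto
    then show ?thesis
      by (metis add.right_neutral scaleR_zero_right)
  qed
  then obtain A B where
    "\<And>i y. (\<Prod>t=1..Q. (x((s, j) := y)) (t, i t)) *\<^sub>R a i = A i + y *\<^sub>R B i"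
    by metis
  then have "decoupled_chaos Q J a (\<lambda>t i. (x((s, j) := y)) (t, i))
      = sum A (PiE {1..Q} J) + y *\<^sub>R sum B (PiE {1..Q} J)" for y
    unfolding decoupled_chaos_def by (simp add: sum.distrib scaleR_sum_right)
  then show ?thesis by blast
qed

lemma separately_convex_norm_chaos:
  fixes a :: "(nat \<Rightarrow> 'i) \<Rightarrow> 'b::real_normed_vector"
  assumes "1 \<le> p"
  shows "separately_convex (\<lambda>x. norm (decoupled_chaos Q J a (\<lambda>t i. x (t, i))) powr p)"
  unfolding separately_convex_def
proof (intro allI)
  fix x :: "nat \<times> 'i \<Rightarrow> real" and c :: "nat \<times> 'i"
  obtain s j where c: "c = (s, j)" by (cases c)
  obtain A B where "\<And>y. decoupled_chaos Q J a (\<lambda>t i. (x((s, j) := y)) (t, i)) = A + y *\<^sub>R B"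
    using decoupled_chaos_affine[of Q J a x s j] by blast
  then show "convex_on UNIV (\<lambda>y. norm (decoupled_chaos Q J a (\<lambda>t i. (x(c := y)) (t, i))) powr p)"
    unfolding c using convex_on_norm_affine_powr[OF assms, of A B] by simp
qed

lemma decoupled_chaos_cong:
  assumes "\<And>t i. (t, i) \<in> coordinates Q J \<Longrightarrow> x t i = y t i"
  shows "decoupled_chaos Q J a x = decoupled_chaos Q J a y"
  unfolding decoupled_chaos_def
  by (intro sum.cong refl arg_cong2[where f = scaleR] prod.cong assms PiE_coordinates)

lemma decoupled_chaos_scale:
  "decoupled_chaos Q J a (\<lambda>t i. c * x t i) = c ^ Q *\<^sub>R decoupled_chaos Q J a x"
  by (simp add: decoupled_chaos_def prod.distrib scaleR_sum_right)

text \<open>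
  A Banach space need not be separable, so sums of measurable functions into it need not be
  measurable.  A linear combination of fixed vectors is measurable because it is a continuous
  function of its coefficient vector, and coefficient vectors form a separable space.
\<close>

lemma borel_measurable_linear_combination:
  fixes b :: "'k \<Rightarrow> 'b::real_normed_vector" and u :: "'k \<Rightarrow> 'm \<Rightarrow> real"
  assumes "\<And>k. k \<in> P \<Longrightarrow> u k \<in> borel_measurable M"
  shows "(\<lambda>\<omega>. \<Sum>k\<in>P. u k \<omega> *\<^sub>R b k) \<in> borel_measurable M"
proof (cases "finite P")
  case True
  then obtain e where e: "bij_betw e {..<card P} P"
    using bij_betw_from_nat_into_finite by blast
  \<comment> \<open>the Borel sets of the sequence space are those of the product because \<open>nat\<close> is countable\<close>
  define v where "v \<omega> n = (if n < card P then u (e n) \<omega> else 0)" for \<omega> n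
  have "(\<lambda>\<omega>. v \<omega> n) \<in> borel_measurable M" for n
    unfolding v_def using assms e by (cases "n < card P") (auto simp: bij_betw_def)
  then have "v \<in> measurable M (PiM UNIV (\<lambda>_. borel))"
    by (intro measurable_PiM_single') (auto simp: space_PiM PiE_def extensional_def)
  then have "v \<in> borel_measurable M"
    by (simp add: measurable_cong_sets[OF refl sets_PiM_equal_borel])
  moreover have "(\<lambda>w. \<Sum>n<card P. w n *\<^sub>R b (e n)) \<in> borel_measurable borel"
    by (intro borel_measurable_continuous_onI continuous_intros continuous_on_product_coordinates)
  ultimately have "(\<lambda>\<omega>. \<Sum>n<card P. v \<omega> n *\<^sub>R b (e n)) \<in> borel_measurable M"
    by (rule measurable_compose)
  moreover have "(\<Sum>k\<in>P. u k \<omega> *\<^sub>R b k) = (\<Sum>n<card P. v \<omega> n *\<^sub>R b (e n))" for \<omega>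
    by (simp add: v_def sum.reindex_bij_betw[OF e, symmetric])
  ultimately show ?thesis
    by simp
qed simp

lemma measurable_norm_chaos:
  fixes a :: "(nat \<Rightarrow> 'i) \<Rightarrow> 'b::real_normed_vector"
  assumes "\<And>t i. (t, i) \<in> coordinates Q J \<Longrightarrow> (\<lambda>\<omega>. x t i \<omega>) \<in> borel_measurable M"
  shows "(\<lambda>\<omega>. norm (decoupled_chaos Q J a (\<lambda>t i. x t i \<omega>)) powr p) \<in> borel_measurable M"
proof -
  have "(\<lambda>\<omega>. decoupled_chaos Q J a (\<lambda>t i. x t i \<omega>)) \<in> borel_measurable M"
    unfolding decoupled_chaos_def
    by (intro borel_measurable_linear_combination borel_measurable_prod assms PiE_coordinates)
  then show ?thesis
    by measurable
qed

lemma norm_chaos_le: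
  fixes a :: "(nat \<Rightarrow> 'i) \<Rightarrow> 'b::real_normed_vector"
  assumes "\<And>t i. (t, i) \<in> coordinates Q J \<Longrightarrow> \<bar>x t i\<bar> \<le> R"
  shows "norm (decoupled_chaos Q J a x) \<le> R ^ Q * (\<Sum>i\<in>PiE {1..Q} J. norm (a i))"
proof -
  have "\<bar>\<Prod>t=1..Q. x t (i t)\<bar> \<le> R ^ Q" if "i \<in> PiE {1..Q} J" for i
  proof -
    have "(\<Prod>t=1..Q. \<bar>x t (i t)\<bar>) \<le> (\<Prod>t=1..Q. R)"
      using that by (intro prod_mono conjI abs_ge_zero assms PiE_coordinates)
    then show ?thesis by (simp add: abs_prod)
  qed
  then show ?thesis
    unfolding decoupled_chaos_def sum_distrib_left
    by (intro sum_norm_le) (auto intro!: mult_right_mono)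
qed

lemma finite_coordinates:
  assumes "\<And>t. t \<in> {1..Q} \<Longrightarrow> finite (J t)"
  shows "finite (coordinates Q J)"
  using assms by (auto simp: coordinates_def)

lemma Lp_norm_scale:
  assumes "0 \<le> c" "0 < p"
  shows "Lp_norm p M (\<lambda>\<omega>. c *\<^sub>R Y \<omega>) = c * Lp_norm p M Y"
  using assms by (simp add: Lp_norm_def powr_mult powr_powr)

text \<open>
  The comparison for chaoses in two families ordered coordinate by coordinate.  The coordinates are
  bounded, so the moments are finite and the inequality passes from nonnegative integrals to
  \<open>Lp_norm\<close>.
\<close>

lemma Lp_norm_chaos_mono:
  fixes a :: "(nat \<Rightarrow> 'i) \<Rightarrow> 'b::banach" and X :: "nat \<Rightarrow> 'i \<Rightarrow> 'm \<Rightarrow> real" and Y :: "nat \<Rightarrow> 'i \<Rightarrow> 'n \<Rightarrow> real"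
  assumes fin: "\<And>t. t \<in> {1..Q} \<Longrightarrow> finite (J t)"
    and M: "prob_space M" and N: "prob_space N"
    and X: "prob_space.indep_vars M (\<lambda>_. borel) (\<lambda>(t, i). X t i) (coordinates Q J)"
    and Y: "prob_space.indep_vars N (\<lambda>_. borel) (\<lambda>(t, i). Y t i) (coordinates Q J)"
    and XR: "\<And>t i. (t, i) \<in> coordinates Q J \<Longrightarrow> AE \<omega> in M. \<bar>X t i \<omega>\<bar> \<le> R"
    and YS: "\<And>t i. (t, i) \<in> coordinates Q J \<Longrightarrow> AE \<omega> in N. \<bar>Y t i \<omega>\<bar> \<le> S"
    and le: "\<And>t i f. (t, i) \<in> coordinates Q J \<Longrightarrow> convex_on UNIV f \<Longrightarrow>
      (LINT \<omega>|M. f (X t i \<omega>)) \<le> (LINT \<omega>|N. f (Y t i \<omega>))"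
    and p: "1 \<le> p"
  shows "Lp_norm p M (\<lambda>\<omega>. decoupled_chaos Q J a (\<lambda>t i. X t i \<omega>))
    \<le> Lp_norm p N (\<lambda>\<omega>. decoupled_chaos Q J a (\<lambda>t i. Y t i \<omega>))"
proof -
  interpret M: prob_space M by fact
  interpret N: prob_space N by fact
  let ?C = "coordinates Q J"
  define g where "g x = norm (decoupled_chaos Q J a (\<lambda>t i. x (t, i))) powr p" for x
  define U where "U \<omega> = norm (decoupled_chaos Q J a (\<lambda>t i. X t i \<omega>)) powr p" for \<omega>
  define V where "V \<omega> = norm (decoupled_chaos Q J a (\<lambda>t i. Y t i \<omega>)) powr p" for \<omega>
  have finC: "finite ?C"
    using fin by (rule finite_coordinates)
  have Xm: "X t i \<in> borel_measurable M" and Ym: "Y t i \<in> borel_measurable N" if "(t, i) \<in> ?C" for t i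
    using X Y that by (auto simp: M.indep_vars_def N.indep_vars_def)
  have U: "g (\<lambda>c\<in>?C. (case c of (t, i) \<Rightarrow> X t i) \<omega>) = U \<omega>" for \<omega>
    unfolding g_def U_def
    by (intro arg_cong[where f = "\<lambda>z. norm z powr p"] decoupled_chaos_cong) auto
  have V: "g (\<lambda>c\<in>?C. (case c of (t, i) \<Rightarrow> Y t i) \<omega>) = V \<omega>" for \<omega>
    unfolding g_def V_def
    by (intro arg_cong[where f = "\<lambda>z. norm z powr p"] decoupled_chaos_cong) auto
  have "(\<integral>\<^sup>+\<omega>. ennreal (g (\<lambda>c\<in>?C. (case c of (t, i) \<Rightarrow> X t i) \<omega>)) \<partial>M)
      \<le> (\<integral>\<^sup>+\<omega>. ennreal (g (\<lambda>c\<in>?C. (case c of (t, i) \<Rightarrow> Y t i) \<omega>)) \<partial>N)"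
  proof (rule indep_separately_convex_mono[OF finC M N X Y, where R = R and S = S])
    show "separately_convex g"
      unfolding g_def using p by (rule separately_convex_norm_chaos)
    show "g \<in> borel_measurable (PiM ?C (\<lambda>_. borel))"
      unfolding g_def by (intro measurable_norm_chaos measurable_component_singleton)
  qed (use XR YS le in \<open>auto simp: g_def\<close>)
  then have UV: "(\<integral>\<^sup>+\<omega>. ennreal (U \<omega>) \<partial>M) \<le> (\<integral>\<^sup>+\<omega>. ennreal (V \<omega>) \<partial>N)"
    unfolding U V .
  have Um: "U \<in> borel_measurable M" and Vm: "V \<in> borel_measurable N"
    unfolding U_def V_def using Xm Ym by (auto intro!: measurable_norm_chaos)
  have "AE \<omega> in N. \<forall>c\<in>?C. \<bar>(case c of (t, i) \<Rightarrow> Y t i) \<omega>\<bar> \<le> S"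
    using finC YS by (intro AE_finite_allI) auto
  then have "AE \<omega> in N. norm (V \<omega>) \<le> (S ^ Q * (\<Sum>i\<in>PiE {1..Q} J. norm (a i))) powr p"
  proof eventually_elim
    fix \<omega> assume "\<forall>c\<in>?C. \<bar>(case c of (t, i) \<Rightarrow> Y t i) \<omega>\<bar> \<le> S"
    then have "norm (decoupled_chaos Q J a (\<lambda>t i. Y t i \<omega>)) \<le> S ^ Q * (\<Sum>i\<in>PiE {1..Q} J. norm (a i))"
      by (intro norm_chaos_le) auto
    then show "norm (V \<omega>) \<le> (S ^ Q * (\<Sum>i\<in>PiE {1..Q} J. norm (a i))) powr p"
      using p by (auto simp: V_def intro!: powr_mono2)
  qed
  then have "integrable N V"
    using Vm by (intro N.integrable_const_bound)
  then have "(\<integral>\<^sup>+\<omega>. ennreal (V \<omega>) \<partial>N) < \<infinity>"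
    by (subst nn_integral_eq_integral) (auto simp: V_def)
  then have "(LINT \<omega>|M. U \<omega>) \<le> (LINT \<omega>|N. V \<omega>)"
    using UV Um Vm by (subst (1 2) integral_eq_nn_integral) (auto simp: U_def V_def intro!: enn2real_mono)
  moreover have "0 \<le> (LINT \<omega>|M. U \<omega>)"
    by (simp add: U_def)
  ultimately show ?thesis
    unfolding Lp_norm_def using p by (intro powr_mono2) (auto simp: U_def V_def)
qed

theorem theorem5p6:
  fixes Q :: nat
    and J :: "nat \<Rightarrow> 'i set"
    and a :: "(nat \<Rightarrow> 'i) \<Rightarrow> 'b::banach"
    and M :: "'m measure" and X :: "nat \<Rightarrow> 'i \<Rightarrow> 'm \<Rightarrow> real"
    and N :: "'n measure" and \<epsilon> :: "nat \<Rightarrow> 'i \<Rightarrow> 'n \<Rightarrow> real"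
    and K p :: real
  assumes fin: "\<And>t. t \<in> {1..Q} \<Longrightarrow> finite (J t)"
    and M: "prob_space M"
    and X_indep: "prob_space.indep_vars M (\<lambda>_. borel) (\<lambda>(t, i). X t i) (coordinates Q J)"
    and X_mean: "\<And>t i. (t, i) \<in> coordinates Q J \<Longrightarrow> (LINT \<omega>|M. X t i \<omega>) = 0"
    and X_var: "\<And>t i. (t, i) \<in> coordinates Q J \<Longrightarrow> (LINT \<omega>|M. (X t i \<omega>)\<^sup>2) = 1"
    and X_bound: "\<And>t i. (t, i) \<in> coordinates Q J \<Longrightarrow> AE \<omega> in M. \<bar>X t i \<omega>\<bar> \<le> K"
    and K: "1 \<le> K"
    and N: "prob_space N"
    and eps_indep: "prob_space.indep_vars N (\<lambda>_. borel) (\<lambda>(t, i). \<epsilon> t i) (coordinates Q J)"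
    and eps_sign: "\<And>t i. (t, i) \<in> coordinates Q J \<Longrightarrow> uniform_sign N (\<epsilon> t i)"
    and p: "1 \<le> p"
  shows "(2 * K) powi (- int Q) * Lp_norm p N (\<lambda>\<omega>. decoupled_chaos Q J a (\<lambda>t i. \<epsilon> t i \<omega>))
           \<le> Lp_norm p M (\<lambda>\<omega>. decoupled_chaos Q J a (\<lambda>t i. X t i \<omega>))
       \<and> Lp_norm p M (\<lambda>\<omega>. decoupled_chaos Q J a (\<lambda>t i. X t i \<omega>))
           \<le> (2 * K) ^ Q * Lp_norm p N (\<lambda>\<omega>. decoupled_chaos Q J a (\<lambda>t i. \<epsilon> t i \<omega>))"
proof -
  interpret M: prob_space M by fact
  interpret N: prob_space N by fact
  let ?C = "coordinates Q J"
  let ?LX = "Lp_norm p M (\<lambda>\<omega>. decoupled_chaos Q J a (\<lambda>t i. X t i \<omega>))"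
  let ?L = "\<lambda>c. Lp_norm p N (\<lambda>\<omega>. decoupled_chaos Q J a (\<lambda>t i. c * \<epsilon> t i \<omega>))"
  let ?LE = "Lp_norm p N (\<lambda>\<omega>. decoupled_chaos Q J a (\<lambda>t i. \<epsilon> t i \<omega>))"
  have K0: "0 < K" using K by simp
  have Xm: "X t i \<in> borel_measurable M" if "(t, i) \<in> ?C" for t i
    using X_indep that by (auto simp: M.indep_vars_def)
  have scaled_indep: "N.indep_vars (\<lambda>_. borel) (\<lambda>(t, i) \<omega>. c * \<epsilon> t i \<omega>) ?C" for c
    using N.indep_vars_compose2[OF eps_indep, of "\<lambda>_ y. c * y" "\<lambda>_. borel"]
    by (simp add: case_prod_beta')
  have scaled_bound: "AE \<omega> in N. \<bar>c * \<epsilon> t i \<omega>\<bar> \<le> \<bar>c\<bar>" if "(t, i) \<in> ?C" for c t i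
    using N.uniform_sign_AE[OF eps_sign[OF that]] by eventually_elim (auto simp: abs_mult)
  have scaled_mean: "(LINT \<omega>|N. f (c * \<epsilon> t i \<omega>)) = two_point_mean c f"
    if "(t, i) \<in> ?C" "convex_on UNIV f" for c t i f
    by (intro N.expectation_scaled_sign eps_sign convex_on_UNIV_measurable that)
  have homogeneous: "?L c = c ^ Q * ?LE" if "0 \<le> c" for c
    using that p by (simp add: decoupled_chaos_scale Lp_norm_scale)
  have LE: "0 \<le> ?LE"
    by (simp add: Lp_norm_def)
  have upper: "?LX \<le> K ^ Q * ?LE"
  proof -
    have "?LX \<le> ?L K"
      using M.convex_le_two_point[OF Xm K0 X_bound X_mean] X_bound p
      by (intro Lp_norm_chaos_mono[OF fin M N X_indep scaled_indep _ scaled_bound])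
        (auto simp: scaled_mean)
    then show ?thesis
      using homogeneous K0 by simp
  qed
  have lower: "(1 / K) ^ Q * ?LE \<le> ?LX"
  proof -
    have "?L (1 / K) \<le> ?LX"
      using M.two_point_convex_le[OF Xm K0 X_bound X_mean X_var] X_bound p
      by (intro Lp_norm_chaos_mono[OF fin N M scaled_indep X_indep scaled_bound])
        (auto simp: scaled_mean simp del: times_divide_eq_left)
    then show ?thesis
      using homogeneous[of "1 / K"] K0 by simp
  qed
  have "(2 * K) powi (- int Q) = (1 / (2 * K)) ^ Q"
    by (simp add: power_int_minus power_one_over inverse_eq_divide)
  also have "\<dots> \<le> (1 / K) ^ Q"
    using K0 by (intro power_mono) (auto simp: field_simps)
  finally have "(2 * K) powi (- int Q) * ?LE \<le> (1 / K) ^ Q * ?LE"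
    using LE by (rule mult_right_mono)
  moreover have "K ^ Q * ?LE \<le> (2 * K) ^ Q * ?LE"
    using LE K0 by (intro mult_right_mono power_mono) auto
  ultimately show ?thesis
    using lower upper by linarith
qed

end
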